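(* Let $k$ be a positive integer and $A$ a stream with $n_A\ge k$ distinct identifiers, and let $h$ be a perfectly random hash function. Run AlphaTCF$(k,A,h)$, let $\mathcal I$ be the final value of its counter $i$ (so the returned threshold is $\alpha^{\mathcal I}$, $\alpha=k/(k+1)$), and let $\mathcal S$ be the number of distinct identifiers of $A$ whose hash value is less than $\alpha^{\mathcal I}$. Then $$\sigma^2\!\left(\mathcal S/\alpha^{\mathcal I}\right)=\frac{(2k+1)n_A^2-(k^2+k)(2n_A-1)-n_A}{2k^2}<\frac{n_A^2}{k-\frac12}.$$
   Context: Identifiers come from $[n]$; a stream is a finite sequence of identifiers. The hash function $h:[n]\to(0,1)$ is perfectly random (i.i.d. Uniform$(0,1)$ values); $h(A)$ is the sequence of hash values in stream order. AlphaTCF$(k,A,h)$: set $\alpha=k/(k+1)$; let the prefix be the shortest prefix of $h(A)$ containing exactly $k$ distinct hash values and the suffix the rest; $D$ := set of distinct hash values in the prefix; $i:=0$; for each $x$ in the suffix, in order: if $x<\alpha^i$ and $x\notin D$, then $i:=i+1$ and $D:=D\cup\{x\}$. Return $\theta=\alpha^i$. *)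

theory Defs
  imports "HOL-Probability.Probability"
begin

text \<open>
  Identifiers are natural numbers, a stream is a list of identifiers, and a random hash function
  is a family \<open>H\<close> of random variables indexed by identifiers: at the outcome \<open>\<omega>\<close>, the hash
  function is \<open>\<lambda>a. H a \<omega>\<close>.
\<close>

definition perfectly_random_hash :: "'w measure \<Rightarrow> nat \<Rightarrow> (nat \<Rightarrow> 'w \<Rightarrow> real) \<Rightarrow> bool" where
  "perfectly_random_hash M n H \<longleftrightarrow>
     (\<forall>a\<in>{1..n}. \<forall>\<omega>\<in>space M. 0 < H a \<omega> \<and> H a \<omega> < 1) \<and>
     prob_space.indep_vars M (\<lambda>_. borel) H {1..n} \<and>
     (\<forall>a\<in>{1..n}. distr M borel (H a) = uniform_measure lborel {0<..<1})"

text \<open>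
  Length of the shortest prefix with exactly \<open>k\<close> distinct entries. If \<open>xs\<close> has fewer than \<open>k\<close>
  distinct entries there is no such prefix and the value is unspecified; for the hash values of
  a stream with at least \<open>k\<close> distinct identifiers this requires a hash collision, which has
  probability zero.
\<close>
definition prefix_length :: "nat \<Rightarrow> real list \<Rightarrow> nat" where
  "prefix_length k xs = (LEAST m. card (set (take m xs)) = k)"

definition alpha :: "nat \<Rightarrow> real" where
  "alpha k = real k / (real k + 1)"

fun alphaTCF_step :: "real \<Rightarrow> real \<Rightarrow> nat \<times> real set \<Rightarrow> nat \<times> real set" where
  "alphaTCF_step \<alpha> x (i, D) = (if x < \<alpha> ^ i \<and> x \<notin> D then (i + 1, insert x D) else (i, D))"

definition alphaTCF_counter :: "nat \<Rightarrow> nat list \<Rightarrow> (nat \<Rightarrow> real) \<Rightarrow> nat" where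
  "alphaTCF_counter k A h =
     (let xs = map h A; m = prefix_length k xs
      in fst (fold (alphaTCF_step (alpha k)) (drop m xs) (0, set (take m xs))))"

definition alphaTCF :: "nat \<Rightarrow> nat list \<Rightarrow> (nat \<Rightarrow> real) \<Rightarrow> real" where
  "alphaTCF k A h = alpha k ^ alphaTCF_counter k A h"

definition sample_size :: "nat \<Rightarrow> nat list \<Rightarrow> (nat \<Rightarrow> real) \<Rightarrow> nat" where
  "sample_size k A h = card {a \<in> set A. h a < alphaTCF k A h}"

end

theory Submission
  imports Defs
begin

text \<open>
  Only first occurrences of identifiers matter, and almost surely no hash values collide, so the
  counter is a Markov chain that moves from \<open>i\<close> to \<open>i + 1\<close> with probability \<open>\<alpha>\<^sup>i\<close>; hence each step
  adds \<open>1 / \<alpha> - 1 = 1 / k\<close> to the expected value of \<open>1 / \<alpha>\<^sup>i\<close>. Write the estimate as \<open>\<Sum>a. X a\<close>, where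
  \<open>X a\<close> is \<open>1 / \<theta>\<close> if \<open>h a < \<theta>\<close> and \<open>0\<close> otherwise. Let \<open>F\<close> be the threshold returned after setting
  the hash values of one or two identifiers to \<open>0\<close>. It is independent of the original values of
  these, they lie below \<open>\<theta>\<close> iff they lie below \<open>F\<close>, and then \<open>\<theta> = F\<close>. Integrating these values out
  gives \<open>E (X a) = 1\<close>, \<open>E (X a * X b) = 1\<close> for \<open>a \<noteq> b\<close>, and \<open>E ((X a)\<^sup>2) = E (1 / F)\<close>, which the chain
  evaluates for each position of \<open>a\<close>.
\<close>

section \<open>The counter on a stream of new identifiers\<close>

text \<open>The algorithm with its state reduced to the counter: for new identifiers without hash
  collisions the test \<open>x \<notin> D\<close> always succeeds. The start value is a parameter so
  that inductions along the list can vary it.\<close>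

definition tcf_count :: "real \<Rightarrow> (nat \<Rightarrow> real) \<Rightarrow> nat list \<Rightarrow> nat \<Rightarrow> nat" where
  "tcf_count \<alpha> h cs i = fold (\<lambda>c i. if h c < \<alpha> ^ i then Suc i else i) cs i"

lemma tcf_count_Nil [simp]: "tcf_count \<alpha> h [] i = i"
  and tcf_count_Cons [simp]:
    "tcf_count \<alpha> h (c # cs) i = tcf_count \<alpha> h cs (if h c < \<alpha> ^ i then Suc i else i)"
  by (simp_all add: tcf_count_def)

lemma tcf_count_ge: "i \<le> tcf_count \<alpha> h cs i"
  by (induction cs arbitrary: i) (auto intro: le_trans[OF le_SucI] dest: Suc_leD)

lemma tcf_count_le: "tcf_count \<alpha> h cs i \<le> i + length cs"
proof (induction cs arbitrary: i)
  case (Cons c cs)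
  show ?case using Cons[of i] Cons[of "Suc i"] by simp
qed simp

lemma tcf_count_upd_notin [simp]:
  "b \<notin> set cs \<Longrightarrow> tcf_count \<alpha> (h(b := y)) cs i = tcf_count \<alpha> h cs i"
  by (induction cs arbitrary: i) auto

text \<open>Once an identifier is below the final threshold, it was below the threshold on arrival, so
  lowering its hash value to \<open>0\<close> does not change the run.\<close>
lemma tcf_count_upd_0:
  assumes "0 < \<alpha>" "\<alpha> \<le> 1"
  defines "F \<equiv> \<lambda>h cs i. \<alpha> ^ tcf_count \<alpha> h cs i"
  shows "h b < F h cs i \<longleftrightarrow> h b < F (h(b := 0)) cs i"
    and "h b < F h cs i \<Longrightarrow> tcf_count \<alpha> h cs i = tcf_count \<alpha> (h(b := 0)) cs i"
proof -
  have "(h b < F h cs i \<longleftrightarrow> h b < F (h(b := 0)) cs i) \<and>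
    (h b < F h cs i \<longrightarrow> tcf_count \<alpha> h cs i = tcf_count \<alpha> (h(b := 0)) cs i)"
  proof (induction cs arbitrary: i)
    case (Cons c cs)
    show ?case
    \<comment> \<open>Only here do the two runs diverge: \<open>b\<close> arrives and is rejected,
      but would be accepted with value \<open>0\<close>. All later thresholds of both runs are at
      most \<open>\<alpha> ^ i \<le> h b\<close>, so both comparisons fail.\<close>
    proof (cases "c = b \<and> \<not> h b < \<alpha> ^ i")
      case True
      have "F g cs j \<le> \<alpha> ^ i" if "i \<le> j" for g j
        unfolding F_def using assms that le_trans[OF that tcf_count_ge]
        by (intro power_decreasing) auto
      from this[of i h] this[of "Suc i" "h(b := 0)"] True show ?thesis
        using assms(1) by (auto simp: F_def fun_upd_def)
    next
      case False
      then show ?thesis using Cons[of i] Cons[of "Suc i"] assms(1) by (auto simp: F_def)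
    qed
  qed (simp add: F_def)
  then show "h b < F h cs i \<longleftrightarrow> h b < F (h(b := 0)) cs i"
    and "h b < F h cs i \<Longrightarrow> tcf_count \<alpha> h cs i = tcf_count \<alpha> (h(b := 0)) cs i" by auto
qed

section \<open>Reduction of a stream to first occurrences\<close>

fun new_elems :: "'a set \<Rightarrow> 'a list \<Rightarrow> 'a list" where
  "new_elems Q [] = []"
| "new_elems Q (b # bs) = (if b \<in> Q then new_elems Q bs else b # new_elems (insert b Q) bs)"

lemma set_new_elems [simp]: "set (new_elems Q bs) = set bs - Q"
  by (induction Q bs rule: new_elems.induct) auto

lemma distinct_new_elems [simp]: "distinct (new_elems Q bs)"
  by (induction Q bs rule: new_elems.induct) auto

text \<open>A rejected identifier stays above the threshold, so repetitions never change the state.\<close>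
lemma fold_alphaTCF_step:
  assumes "inj_on h (Q \<union> set bs)" "D \<subseteq> h ` Q" "\<And>q. q \<in> Q \<Longrightarrow> h q \<notin> D \<Longrightarrow> \<alpha> ^ i \<le> h q"
    "0 < \<alpha>" "\<alpha> \<le> 1"
  shows "fst (fold (alphaTCF_step \<alpha>) (map h bs) (i, D)) = tcf_count \<alpha> h (new_elems Q bs) i"
  using assms
proof (induction bs arbitrary: Q D i)
  case (Cons b bs)
  show ?case
  proof (cases "b \<in> Q")
    case True
    have "h b \<in> D \<or> \<alpha> ^ i \<le> h b" using Cons.prems(3)[OF True] by blast
    then have "alphaTCF_step \<alpha> (h b) (i, D) = (i, D)" by auto
    moreover have "inj_on h (Q \<union> set bs)" using Cons.prems(1) by (rule inj_on_subset) auto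
    ultimately show ?thesis using Cons.IH[of Q D i] Cons.prems True by simp
  next
    case False
    have "h b \<notin> h ` Q" using Cons.prems(1) False by (auto simp: inj_on_def)
    then have nb: "h b \<notin> D" using Cons.prems(2) by blast
    have inj: "inj_on h (insert b Q \<union> set bs)" using Cons.prems(1) by simp
    have dec: "\<alpha> ^ Suc i \<le> \<alpha> ^ i" using Cons.prems(4,5) by (simp add: mult_left_le_one_le)
    show ?thesis
    proof (cases "h b < \<alpha> ^ i")
      case True
      have "fst (fold (alphaTCF_step \<alpha>) (map h bs) (Suc i, insert (h b) D))
          = tcf_count \<alpha> h (new_elems (insert b Q) bs) (Suc i)"
      proof (rule Cons.IH[OF inj])
        fix q assume "q \<in> insert b Q" "h q \<notin> insert (h b) D"
        then show "\<alpha> ^ Suc i \<le> h q" using Cons.prems(3)[of q] dec by auto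
      qed (use Cons.prems in auto)
      then show ?thesis using True nb False by simp
    next
      case nl: False
      have "fst (fold (alphaTCF_step \<alpha>) (map h bs) (i, D))
          = tcf_count \<alpha> h (new_elems (insert b Q) bs) i"
        using Cons.prems nl by (intro Cons.IH[OF inj]) auto
      then show ?thesis using False nl by simp
    qed
  qed
qed simp

text \<open>One more entry raises the number of distinct entries by at most one, so the prefixes
  attain every count up to that of the whole list.\<close>

lemma ex_prefix_card:
  "k \<le> card (set xs) \<Longrightarrow> \<exists>m\<le>length xs. card (set (take m xs)) = k"
proof (induction xs rule: rev_induct)
  case (snoc x xs)
  show ?case
  proof (cases "k \<le> card (set xs)")
    case True
    then obtain m where "m \<le> length xs" "card (set (take m xs)) = k" using snoc.IH by blast
    then show ?thesis by (intro exI[of _ m]) simp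
  next
    case False
    then have "card (set (xs @ [x])) = k" using snoc.prems by (simp add: card_insert_if split: if_splits)
    then show ?thesis by (intro exI[of _ "Suc (length xs)"]) simp
  qed
qed simp

text \<open>\<open>P\<close> collects the identifiers of the prefix and \<open>cs\<close> the later
  first occurrences. Both are fixed before \<open>h\<close>: an injective \<open>h\<close> preserves
  the number of distinct entries of each prefix, so the prefix length depends on \<open>A\<close>
  alone. This permits integration over \<open>h\<close> with \<open>cs\<close> held
  constant.\<close>

lemma alphaTCF_counter_inj:
  fixes A :: "nat list"
  assumes "k \<le> card (set A)" "k > 0"
  obtains P cs where "card P = k" "finite P" "distinct cs" "set A = P \<union> set cs" "P \<inter> set cs = {}"
    "\<And>h. inj_on h (set A) \<Longrightarrow> alphaTCF_counter k A h = tcf_count (alpha k) h cs 0"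
proof -
  define m where "m = (LEAST m. card (set (take m A)) = k)"
  define P where "P = set (take m A)"
  define cs where "cs = new_elems P (drop m A)"
  have un: "set A = P \<union> set (drop m A)"
    unfolding P_def by (metis append_take_drop_id set_append)
  have "card P = k"
    unfolding P_def m_def by (rule LeastI_ex) (use ex_prefix_card[OF assms(1)] in blast)
  moreover have "alphaTCF_counter k A h = tcf_count (alpha k) h cs 0" if "inj_on h (set A)" for h
  proof -
    have "card (set (take j (map h A))) = card (set (take j A))" for j
    proof -
      have "inj_on h (set (take j A))" using that by (rule inj_on_subset) (rule set_take_subset)
      then show ?thesis by (simp add: take_map card_image)
    qed
    then have "prefix_length k (map h A) = m" by (simp add: prefix_length_def m_def)
    then have "alphaTCF_counter k A h
        = fst (fold (alphaTCF_step (alpha k)) (map h (drop m A)) (0, h ` P))"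
      by (simp add: alphaTCF_counter_def Let_def drop_map take_map P_def)
    also have "\<dots> = tcf_count (alpha k) h cs 0"
      unfolding cs_def using that assms(2)
      by (intro fold_alphaTCF_step) (auto simp: un alpha_def)
    finally show ?thesis .
  qed
  ultimately show ?thesis using that[of P cs] un by (auto simp: cs_def P_def)
qed

section \<open>Integration over independent uniform hash values\<close>

abbreviation unif :: "real measure" where "unif \<equiv> uniform_measure lborel {0<..<1}"

abbreviation hashes :: "nat set \<Rightarrow> (nat \<Rightarrow> real) measure" where "hashes U \<equiv> Pi\<^sub>M U (\<lambda>_. unif)"

lemma prob_space_unif: "prob_space unif"
  by (rule prob_space_uniform_measure) auto

lemma prob_space_hashes: "prob_space (hashes U)"
  by (intro prob_space_PiM prob_space_unif)

text \<open>The start counter may depend on \<open>x\<close> because it is already random after one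
  step of the induction.\<close>

lemma measurable_tcf_count:
  assumes f: "\<And>c. (\<lambda>x. f x c) \<in> borel_measurable M" and "g \<in> M \<rightarrow>\<^sub>M count_space UNIV"
  shows "(\<lambda>x. tcf_count \<alpha> (f x) cs (g x)) \<in> M \<rightarrow>\<^sub>M count_space UNIV"
  using assms(2)
proof (induction cs arbitrary: g)
  case (Cons c cs)
  note [measurable] = Cons.prems f[of c]
  have [measurable]: "(\<lambda>x. \<alpha> ^ g x) \<in> borel_measurable M"
    by (rule measurable_compose[OF Cons.prems]) simp
  have "(\<lambda>x. if f x c < \<alpha> ^ g x then Suc (g x) else g x) \<in> M \<rightarrow>\<^sub>M count_space UNIV"
    by measurable
  from Cons.IH[OF this] show ?case by simp
qed simp

text \<open>Outside \<open>U\<close>, extensionality fixes the coordinate to the constant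
  \<open>undefined\<close>.\<close>

lemma measurable_hash [measurable]: "(\<lambda>h. h c) \<in> borel_measurable (hashes U)"
proof (cases "c \<in> U")
  case True
  then have "(\<lambda>h. h c) \<in> hashes U \<rightarrow>\<^sub>M unif" by (rule measurable_component_singleton)
  then show ?thesis by (simp add: measurable_def space_uniform_measure)
next
  case False
  then have "h c = undefined" if "h \<in> space (hashes U)" for h
    using PiE_arb[of h U _ c] that by (simp add: space_PiM)
  then have "(\<lambda>h. h c) \<in> borel_measurable (hashes U)
      \<longleftrightarrow> (\<lambda>_. undefined :: real) \<in> borel_measurable (hashes U)"
    by (rule measurable_cong)
  then show ?thesis by simp
qed

lemma measurable_hash_upd:
  "\<And>c. (\<lambda>h. f h c) \<in> borel_measurable M \<Longrightarrow> (\<lambda>h. ((f h)(b := y)) c) \<in> borel_measurable M"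
  for f :: "'x \<Rightarrow> nat \<Rightarrow> real"
  by (simp add: fun_upd_apply)

lemma measurable_tcf_count_hashes [measurable]:
  "(\<lambda>h. tcf_count \<alpha> h cs i) \<in> hashes U \<rightarrow>\<^sub>M count_space UNIV"
  by (rule measurable_tcf_count[where f="\<lambda>h. h", OF measurable_hash]) simp

lemma measurable_tcf_count_upd [measurable]:
  "(\<lambda>h. tcf_count \<alpha> (h(b := y)) cs i) \<in> hashes U \<rightarrow>\<^sub>M count_space UNIV"
  by (rule measurable_tcf_count[where f="\<lambda>h. h(b := y)",
        OF measurable_hash_upd[where f="\<lambda>h. h", OF measurable_hash]]) simp

lemma measurable_tcf_count_upd2 [measurable]:
  "(\<lambda>h. tcf_count \<alpha> (h(b := y, c := z)) cs i) \<in> hashes U \<rightarrow>\<^sub>M count_space UNIV"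
  by (rule measurable_tcf_count[where f="\<lambda>h. h(b := y, c := z)",
        OF measurable_hash_upd[where f="\<lambda>h. h(b := y)",
          OF measurable_hash_upd[where f="\<lambda>h. h", OF measurable_hash]]]) simp

text \<open>Only the finitely many values \<open>g 0, ..., g N\<close> occur, so their largest
  modulus is a bound.\<close>

lemma integrable_bounded_nat:
  fixes g :: "nat \<Rightarrow> real"
  assumes "finite_measure M" and "Y \<in> M \<rightarrow>\<^sub>M count_space UNIV"
    and "\<And>x. Y x \<le> N"
  shows "integrable M (\<lambda>x. g (Y x))"
proof -
  interpret finite_measure M by fact
  have "norm (g (Y x)) \<le> Max ((\<lambda>n. \<bar>g n\<bar>) ` {..N})" for x
    using assms(3)[of x] by (auto intro!: Max_ge)
  moreover have "(\<lambda>x. g (Y x)) \<in> borel_measurable M"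
    by (rule measurable_compose[OF assms(2)]) simp
  ultimately show ?thesis by (intro integrable_const_bound) auto
qed

lemma integrable_tcf_count:
  fixes g :: "nat \<Rightarrow> real"
  shows "integrable (hashes U) (\<lambda>h. g (tcf_count \<alpha> h cs i))"
  by (rule integrable_bounded_nat[where Y="\<lambda>h. tcf_count \<alpha> h cs i" and N="i + length cs"])
    (simp_all add: prob_space.finite_measure[OF prob_space_hashes] measurable_tcf_count_hashes tcf_count_le)

lemma integrable_tcf_count_upd:
  fixes g :: "nat \<Rightarrow> real"
  shows "integrable (hashes U) (\<lambda>h. g (tcf_count \<alpha> (h(b := y)) cs i))"
  by (rule integrable_bounded_nat[where Y="\<lambda>h. tcf_count \<alpha> (h(b := y)) cs i" and N="i + length cs"])
    (simp_all add: prob_space.finite_measure[OF prob_space_hashes] measurable_tcf_count_upd tcf_count_le)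

lemma integrable_tcf_count_upd2:
  fixes g :: "nat \<Rightarrow> real"
  shows "integrable (hashes U) (\<lambda>h. g (tcf_count \<alpha> (h(b := y, c := z)) cs i))"
  by (rule integrable_bounded_nat[where Y="\<lambda>h. tcf_count \<alpha> (h(b := y, c := z)) cs i" and N="i + length cs"])
    (simp_all add: prob_space.finite_measure[OF prob_space_hashes] measurable_tcf_count_upd2 tcf_count_le)

section \<open>Integrating out a single hash value\<close>

lemma integrable_If_0:
  fixes f :: "_ \<Rightarrow> real"
  assumes "integrable M f" "Measurable.pred M P"
  shows "integrable M (\<lambda>x. if P x then f x else 0)"
proof (rule Bochner_Integration.integrable_bound[OF assms(1)])
  note [measurable] = borel_measurable_integrable[OF assms(1)] assms(2)
  show "(\<lambda>x. if P x then f x else 0) \<in> borel_measurable M" by measurable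
qed simp

text \<open>Fubini with the coordinate \<open>a\<close> innermost gives the integral of
  \<open>G\<close> over the other coordinates. As \<open>G\<close> ignores \<open>a\<close>, that
  coordinate can be integrated back in, and both sides live on the same product space.\<close>

lemma integral_resample:
  fixes F G :: "(nat \<Rightarrow> real) \<Rightarrow> real"
  assumes "finite U" "a \<in> U" "integrable (hashes U) F" "integrable (hashes U) G"
    and "\<And>h. integral\<^sup>L unif (\<lambda>y. F (h(a := y))) = G h"
    and "\<And>h y. G (h(a := y)) = G h"
  shows "integral\<^sup>L (hashes U) F = integral\<^sup>L (hashes U) G"
proof -
  interpret P: prob_space unif by (rule prob_space_unif)
  interpret product_sigma_finite "\<lambda>_::nat. unif"
    by standard
  define V where "V = U - {a}"
  have V: "finite V" "a \<notin> V" and U: "U = insert a V" using assms(1,2) by (auto simp: V_def)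
  have "integral\<^sup>L (hashes U) F = (\<integral>h. G h \<partial>hashes V)"
    using product_integral_insert[OF V, of F] assms(3,5) by (simp add: U)
  also have "\<dots> = (\<integral>h. (\<integral>y. G (h(a := y)) \<partial>unif) \<partial>hashes V)"
    by (simp add: assms(6) P.prob_space)
  also have "\<dots> = integral\<^sup>L (hashes U) G"
    using product_integral_insert[OF V, of G] assms(4) by (simp add: U)
  finally show ?thesis .
qed

lemma integral_unif_threshold:
  assumes "0 \<le> p" "p \<le> 1"
  shows "(\<integral>y. (if y < p then u else v) \<partial>unif) = p * u + (1 - p) * v"
proof -
  interpret prob_space unif by (rule prob_space_unif)
  have "{0<..<1::real} \<inter> {..<p} = {0<..<p}" using assms by auto
  then have m: "measure unif {..<p} = p"
    using assms by (simp add: measure_uniform_measure)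
  have "(\<integral>y. (if y < p then u else v) \<partial>unif)
      = (\<integral>y. v + (u - v) * indicator {..<p} y \<partial>unif)"
    by (intro Bochner_Integration.integral_cong) (auto simp: indicator_def)
  also have "\<dots> = v + (u - v) * p"
  proof -
    have "integrable unif (\<lambda>y. (u - v) * indicator {..<p} y)"
      by (intro integrable_mult_right integrable_real_indicator) (auto simp: emeasure_eq_measure)
    then show ?thesis
      by (subst Bochner_Integration.integral_add) (simp_all add: prob_space m)
  qed
  finally show ?thesis by (simp add: algebra_simps)
qed

text \<open>Given all coordinates except \<open>a\<close>, the quantities \<open>p\<close>,
  \<open>G1\<close> and \<open>G0\<close> are constants, and the uniform value \<open>h a\<close>
  falls below \<open>p h\<close> with probability \<open>p h\<close>.\<close>

lemma integral_threshold:
  assumes "finite U" "a \<in> U"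
    and [measurable]: "p \<in> borel_measurable (hashes U)" and p: "\<And>h. 0 \<le> p h" "\<And>h. p h \<le> 1"
    and int: "integrable (hashes U) G1" "integrable (hashes U) G0"
    and inv: "\<And>h y. p (h(a := y)) = p h" "\<And>h y. G1 (h(a := y)) = G1 h" "\<And>h y. G0 (h(a := y)) = G0 h"
  shows "(\<integral>h. (if h a < p h then G1 h else G0 h) \<partial>hashes U)
       = (\<integral>h. p h * G1 h + (1 - p h) * G0 h \<partial>hashes U)"
proof -
  note [measurable] = borel_measurable_integrable[OF int(1)] borel_measurable_integrable[OF int(2)]
  have bound: "integrable (hashes U) (\<lambda>h. \<bar>G1 h\<bar> + \<bar>G0 h\<bar>)" using int by simp
  show ?thesis
  proof (rule integral_resample[OF assms(1,2)])
    show "integrable (hashes U) (\<lambda>h. if h a < p h then G1 h else G0 h)"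
      by (rule Bochner_Integration.integrable_bound[OF bound]) auto
    \<comment> \<open>A convex combination is dominated by the same integrable function as the
      conditional.\<close>
    have "\<bar>p h * G1 h + (1 - p h) * G0 h\<bar> \<le> \<bar>G1 h\<bar> + \<bar>G0 h\<bar>" for h
    proof -
      have "\<bar>p h * G1 h + (1 - p h) * G0 h\<bar> \<le> p h * \<bar>G1 h\<bar> + (1 - p h) * \<bar>G0 h\<bar>"
        using p[of h] abs_triangle_ineq[of "p h * G1 h" "(1 - p h) * G0 h"] by (simp add: abs_mult)
      also have "\<dots> \<le> \<bar>G1 h\<bar> + \<bar>G0 h\<bar>"
        using p[of h] by (intro add_mono mult_left_le_one_le) auto
      finally show ?thesis .
    qed
    then show "integrable (hashes U) (\<lambda>h. p h * G1 h + (1 - p h) * G0 h)"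
      by (intro Bochner_Integration.integrable_bound[OF bound]) auto
  qed (simp_all add: inv integral_unif_threshold p cong: if_cong)
qed

text \<open>With the other values fixed, \<open>h a\<close> hits the single point \<open>h b\<close>
  with probability \<open>0\<close>, and there are only finitely many pairs.\<close>

lemma AE_hashes_inj_on:
  assumes "finite U"
  shows "AE h in hashes U. inj_on h U"
proof -
  interpret P: prob_space "hashes U" by (rule prob_space_hashes)
  have "AE h in hashes U. h a \<noteq> h b" if "a \<in> U" "a \<noteq> b" for a b
  proof -
    have "(\<integral>h. indicator {h \<in> space (hashes U). h a = h b} h \<partial>hashes U)
        = (\<integral>h. (if h a = h b then 1 else 0::real) \<partial>hashes U)"
      by (intro Bochner_Integration.integral_cong) auto
    also have "\<dots> = (\<integral>h. 0 \<partial>hashes U)"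
    proof (rule integral_resample[OF assms \<open>a \<in> U\<close>])
      fix h :: "nat \<Rightarrow> real"
      have "(\<integral>y. (if (h(a := y)) a = (h(a := y)) b then 1 else 0::real) \<partial>unif)
          = (\<integral>y. indicator {h b} y \<partial>unif)"
        using that by (intro Bochner_Integration.integral_cong) (auto simp: indicator_def)
      also have "\<dots> = measure unif {h b}" by simp
      also have "\<dots> = 0"
      proof -
        have "emeasure lborel ({0<..<1} \<inter> {h b}) = 0"
          by (rule emeasure_lborel_countable) auto
        then show ?thesis by (simp add: measure_uniform_measure measure_def)
      qed
      finally show "(\<integral>y. (if (h(a := y)) a = (h(a := y)) b then 1 else 0::real) \<partial>unif) = 0" .
    qed (auto intro!: P.integrable_const_bound[where B=1])
    finally have "P.prob {h \<in> space (hashes U). h a = h b} = 0" by simp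
    then have "AE h in hashes U. h \<notin> {h \<in> space (hashes U). h a = h b}"
      by (subst P.prob_eq_0[symmetric]) auto
    then show ?thesis by (rule AE_mp) (rule AE_I2, simp)
  qed
  then have "AE h in hashes U. \<forall>a\<in>U. \<forall>b\<in>U. a \<noteq> b \<longrightarrow> h a \<noteq> h b"
    using assms by (auto simp: AE_finite_all)
  then show ?thesis by eventually_elim (auto simp: inj_on_def)
qed

section \<open>Moments of the estimate\<close>

text \<open>One transition of the Markov chain. \<open>G j\<close> stands for a functional of the
  remaining run started at \<open>j\<close>, which no longer reads the hash value of
  \<open>a\<close>.\<close>

lemma integral_tcf_count_step:
  fixes G :: "nat \<Rightarrow> (nat \<Rightarrow> real) \<Rightarrow> real"
  assumes "finite U" "a \<in> U" "0 < \<alpha>" "\<alpha> \<le> 1"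
    and "\<And>j. integrable (hashes U) (G j)" and "\<And>j h y. G j (h(a := y)) = G j h"
  shows "(\<integral>h. G (if h a < \<alpha> ^ i then Suc i else i) h \<partial>hashes U)
       = \<alpha> ^ i * (\<integral>h. G (Suc i) h \<partial>hashes U) + (1 - \<alpha> ^ i) * (\<integral>h. G i h \<partial>hashes U)"
proof -
  have "(\<integral>h. G (if h a < \<alpha> ^ i then Suc i else i) h \<partial>hashes U)
      = (\<integral>h. (if h a < \<alpha> ^ i then G (Suc i) h else G i h) \<partial>hashes U)"
    by (intro Bochner_Integration.integral_cong) auto
  also have "\<dots> = (\<integral>h. \<alpha> ^ i * G (Suc i) h + (1 - \<alpha> ^ i) * G i h \<partial>hashes U)"
    using assms by (intro integral_threshold) (auto simp: power_le_one)
  also have "\<dots> = \<alpha> ^ i * (\<integral>h. G (Suc i) h \<partial>hashes U) + (1 - \<alpha> ^ i) * (\<integral>h. G i h \<partial>hashes U)"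
    using assms(5) by simp
  finally show ?thesis .
qed

text \<open>From state \<open>i\<close> the expected gain is \<open>\<alpha> ^ i * (1 / \<alpha> ^
  Suc i - 1 / \<alpha> ^ i) = 1 / \<alpha> - 1\<close>, whatever \<open>i\<close> is.\<close>

lemma expectation_inverse_threshold:
  assumes "finite U" "0 < \<alpha>" "\<alpha> \<le> 1" "distinct cs" "set cs \<subseteq> U"
  shows "(\<integral>h. 1 / \<alpha> ^ tcf_count \<alpha> h cs i \<partial>hashes U) = 1 / \<alpha> ^ i + length cs * (1 / \<alpha> - 1)"
  using assms(4,5)
proof (induction cs arbitrary: i)
  case Nil
  then show ?case by (simp add: prob_space.prob_space[OF prob_space_hashes])
next
  case (Cons c cs)
  have "(\<integral>h. 1 / \<alpha> ^ tcf_count \<alpha> h (c # cs) i \<partial>hashes U)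
    = \<alpha> ^ i * (\<integral>h. 1 / \<alpha> ^ tcf_count \<alpha> h cs (Suc i) \<partial>hashes U)
      + (1 - \<alpha> ^ i) * (\<integral>h. 1 / \<alpha> ^ tcf_count \<alpha> h cs i \<partial>hashes U)"
    unfolding tcf_count_Cons
    using assms Cons.prems
    by (intro integral_tcf_count_step[where G="\<lambda>j h. 1 / \<alpha> ^ tcf_count \<alpha> h cs j"]
      integrable_tcf_count[where g="\<lambda>j. 1 / \<alpha> ^ j"]) auto
  also have "\<dots> = \<alpha> ^ i * (1 / \<alpha> ^ Suc i + length cs * (1 / \<alpha> - 1))
      + (1 - \<alpha> ^ i) * (1 / \<alpha> ^ i + length cs * (1 / \<alpha> - 1))"
    using Cons by simp
  also have "\<dots> = 1 / \<alpha> ^ i + length (c # cs) * (1 / \<alpha> - 1)"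
    using assms(2) by (simp add: field_simps)
  finally show ?case .
qed

text \<open>With value \<open>0\<close>, \<open>b\<close> is always accepted, which multiplies the
  inverse threshold reached after \<open>us\<close> by \<open>1 / \<alpha>\<close>. Every other
  identifier adds \<open>1 / \<alpha> - 1\<close> in expectation when it arrives, so the gains from
  \<open>us\<close> are scaled and those from \<open>vs\<close> are not.\<close>

lemma expectation_inverse_threshold_upd:
  assumes "finite U" "0 < \<alpha>" "\<alpha> \<le> 1" "distinct (us @ b # vs)" "set (us @ b # vs) \<subseteq> U"
  shows "(\<integral>h. 1 / \<alpha> ^ tcf_count \<alpha> (h(b := 0)) (us @ b # vs) i \<partial>hashes U)
       = (1 / \<alpha> ^ i + length us * (1 / \<alpha> - 1)) / \<alpha> + length vs * (1 / \<alpha> - 1)"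
  using assms(4,5)
proof (induction us arbitrary: i)
  case Nil
  then have eq: "tcf_count \<alpha> (h(b := 0)) ([] @ b # vs) i = tcf_count \<alpha> h vs (Suc i)" for h
    using assms(2) tcf_count_upd_notin[of b vs \<alpha> h 0 "Suc i"] by (simp del: tcf_count_upd_notin)
  show ?case
    unfolding eq
    using Nil expectation_inverse_threshold[OF assms(1-3), of vs "Suc i"] by (simp add: mult.commute)
next
  case (Cons c us)
  let ?G = "\<lambda>j h. 1 / \<alpha> ^ tcf_count \<alpha> (h(b := 0)) (us @ b # vs) j"
  have [simp]: "c \<noteq> b" "b \<noteq> c" "c \<notin> set (us @ b # vs)" using Cons.prems by auto
  have "(\<integral>h. 1 / \<alpha> ^ tcf_count \<alpha> (h(b := 0)) ((c # us) @ b # vs) i \<partial>hashes U)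
    = (\<integral>h. ?G (if h c < \<alpha> ^ i then Suc i else i) h \<partial>hashes U)"
    by simp
  also have "\<dots> = \<alpha> ^ i * (\<integral>h. ?G (Suc i) h \<partial>hashes U) + (1 - \<alpha> ^ i) * (\<integral>h. ?G i h \<partial>hashes U)"
  proof (rule integral_tcf_count_step[OF assms(1) _ assms(2,3)])
    \<comment> \<open>Exchanging the updates puts the one at \<open>c\<close> outermost, where it
      has no effect because \<open>c\<close> does not occur in the remaining list.\<close>
    show "?G j (h(c := y)) = ?G j h" for j h y
      by (subst fun_upd_twist[of c b]) (simp_all del: set_append)
    show "integrable (hashes U) (?G j)" for j
      by (rule integrable_tcf_count_upd[where g="\<lambda>j. 1 / \<alpha> ^ j"])
  qed (use Cons.prems in auto)
  also have "\<dots> = \<alpha> ^ i * ((1 / \<alpha> ^ Suc i + length us * (1 / \<alpha> - 1)) / \<alpha> + length vs * (1 / \<alpha> - 1))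
      + (1 - \<alpha> ^ i) * ((1 / \<alpha> ^ i + length us * (1 / \<alpha> - 1)) / \<alpha> + length vs * (1 / \<alpha> - 1))"
    using Cons.prems by (subst (1 2) Cons.IH) auto
  also have "\<dots> = (1 / \<alpha> ^ i + length (c # us) * (1 / \<alpha> - 1)) / \<alpha> + length vs * (1 / \<alpha> - 1)"
    using assms(2) by (simp add: field_simps)
  finally show ?case .
qed

section \<open>Inclusion of one or two identifiers in the sample\<close>

text \<open>On the right, \<open>h b\<close> enters only through the comparison, which is the form
  needed to integrate it out.\<close>

lemma if_sampled_upd_0:
  assumes "0 < \<alpha>" "\<alpha> \<le> 1"
  shows "(if h b < \<alpha> ^ tcf_count \<alpha> h cs i then Q (tcf_count \<alpha> h cs i) else 0)
    = (if h b < \<alpha> ^ tcf_count \<alpha> (h(b := 0)) cs i then Q (tcf_count \<alpha> (h(b := 0)) cs i) else 0)"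
  using tcf_count_upd_0[OF assms, of h b cs i] by metis

text \<open>The modified threshold is independent of \<open>h b\<close>, so the comparison turns
  into the factor \<open>\<alpha> ^ tcf_count \<alpha> (h(b := 0)) cs i\<close>. The first moment
  takes \<open>g j = 1 / \<alpha> ^ j\<close>, the diagonal of the second moment its square.\<close>

lemma expectation_sampled:
  fixes g :: "nat \<Rightarrow> real"
  assumes "finite U" "0 < \<alpha>" "\<alpha> \<le> 1" "b \<in> U"
  shows "(\<integral>h. (if h b < \<alpha> ^ tcf_count \<alpha> h cs i then g (tcf_count \<alpha> h cs i) else 0) \<partial>hashes U)
    = (\<integral>h. \<alpha> ^ tcf_count \<alpha> (h(b := 0)) cs i * g (tcf_count \<alpha> (h(b := 0)) cs i) \<partial>hashes U)"
proof -
  let ?R = "\<lambda>h. tcf_count \<alpha> (h(b := 0)) cs i"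
  have [measurable]: "(\<lambda>h. \<alpha> ^ ?R h) \<in> borel_measurable (hashes U)"
    by (rule borel_measurable_integrable[OF integrable_tcf_count_upd])
  have "(\<integral>h. (if h b < \<alpha> ^ tcf_count \<alpha> h cs i then g (tcf_count \<alpha> h cs i) else 0) \<partial>hashes U)
    = (\<integral>h. (if h b < \<alpha> ^ ?R h then g (?R h) else 0) \<partial>hashes U)"
    by (subst if_sampled_upd_0[OF assms(2,3)]) simp
  also have "\<dots> = (\<integral>h. \<alpha> ^ ?R h * g (?R h) + (1 - \<alpha> ^ ?R h) * 0 \<partial>hashes U)"
    using assms integrable_tcf_count_upd
    by (intro integral_threshold) (auto simp: power_le_one)
  finally show ?thesis by simp
qed

text \<open>First \<open>h b\<close> is integrated out, then \<open>h c\<close> in the run where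
  \<open>b\<close> already has value \<open>0\<close>. Each elimination contributes one threshold
  factor, hence the square.\<close>

lemma expectation_sampled_pair:
  fixes g :: "nat \<Rightarrow> real" and cs :: "nat list" and i :: nat
  assumes "finite U" "0 < \<alpha>" "\<alpha> \<le> 1" "b \<in> U" "c \<in> U" "b \<noteq> c"
  defines "R \<equiv> \<lambda>h. tcf_count \<alpha> h cs i"
  shows "(\<integral>h. (if h b < \<alpha> ^ R h \<and> h c < \<alpha> ^ R h then g (R h) else 0) \<partial>hashes U)
    = (\<integral>h. (\<alpha> ^ R (h(b := 0, c := 0)))\<^sup>2 * g (R (h(b := 0, c := 0))) \<partial>hashes U)"
proof -
  let ?Rb = "\<lambda>h. R (h(b := 0))" and ?Rbc = "\<lambda>h. R (h(b := 0, c := 0))"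
  have intb: "integrable (hashes U) (\<lambda>h. f (?Rb h))" for f :: "nat \<Rightarrow> real"
    unfolding R_def by (rule integrable_tcf_count_upd)
  have intbc: "integrable (hashes U) (\<lambda>h. f (?Rbc h))" for f :: "nat \<Rightarrow> real"
    unfolding R_def by (rule integrable_tcf_count_upd2)
  have [measurable]: "(\<lambda>h. \<alpha> ^ ?Rb h) \<in> borel_measurable (hashes U)"
    "(\<lambda>h. \<alpha> ^ ?Rbc h) \<in> borel_measurable (hashes U)"
    by (rule borel_measurable_integrable[OF intb[where f="\<lambda>j. \<alpha> ^ j"]]
        borel_measurable_integrable[OF intbc[where f="\<lambda>j. \<alpha> ^ j"]])+
  let ?Q = "\<lambda>h. if h c < \<alpha> ^ ?Rb h then g (?Rb h) else 0"
  have "(\<integral>h. (if h b < \<alpha> ^ R h \<and> h c < \<alpha> ^ R h then g (R h) else 0) \<partial>hashes U)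
    = (\<integral>h. (if h b < \<alpha> ^ ?Rb h then ?Q h else 0) \<partial>hashes U)"
  \<comment> \<open>The condition on \<open>h c\<close> is carried along as part of the function of
    the counter while \<open>b\<close> is set to \<open>0\<close>.\<close>
  proof (rule Bochner_Integration.integral_cong[OF refl])
    fix h
    show "(if h b < \<alpha> ^ R h \<and> h c < \<alpha> ^ R h then g (R h) else 0)
        = (if h b < \<alpha> ^ ?Rb h then ?Q h else 0)"
      using if_sampled_upd_0[OF assms(2,3), of h b cs i "\<lambda>r. if h c < \<alpha> ^ r then g r else 0"]
      unfolding R_def by (auto split: if_splits)
  qed
  also have "\<dots> = (\<integral>h. \<alpha> ^ ?Rb h * ?Q h + (1 - \<alpha> ^ ?Rb h) * 0 \<partial>hashes U)"
  proof (rule integral_threshold[OF assms(1) \<open>b \<in> U\<close>])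
    show "integrable (hashes U) ?Q" by (rule integrable_If_0[OF intb]) measurable
  qed (use assms(2,3,6) in \<open>auto simp: power_le_one\<close>)
  \<comment> \<open>The same replacement for \<open>c\<close>, applied to \<open>h(b := 0)\<close>;
    since \<open>b \<noteq> c\<close>, this function still has the value \<open>h c\<close> at
    \<open>c\<close>.\<close>
  also have "\<dots> = (\<integral>h. (if h c < \<alpha> ^ ?Rbc h then \<alpha> ^ ?Rbc h * g (?Rbc h) else 0) \<partial>hashes U)"
  proof (rule Bochner_Integration.integral_cong[OF refl])
    fix h
    show "\<alpha> ^ ?Rb h * ?Q h + (1 - \<alpha> ^ ?Rb h) * 0
        = (if h c < \<alpha> ^ ?Rbc h then \<alpha> ^ ?Rbc h * g (?Rbc h) else 0)"
      using if_sampled_upd_0[OF assms(2,3), of "h(b := 0)" c cs i "\<lambda>r. \<alpha> ^ r * g r"] \<open>b \<noteq> c\<close>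
      unfolding R_def by (simp split: if_splits)
  qed
  also have "\<dots> = (\<integral>h. \<alpha> ^ ?Rbc h * (\<alpha> ^ ?Rbc h * g (?Rbc h)) + (1 - \<alpha> ^ ?Rbc h) * 0 \<partial>hashes U)"
  proof (rule integral_threshold[OF assms(1) \<open>c \<in> U\<close>])
    show "integrable (hashes U) (\<lambda>h. \<alpha> ^ ?Rbc h * g (?Rbc h))" by (rule intbc)
    show "\<alpha> ^ ?Rbc (h(c := y)) = \<alpha> ^ ?Rbc h"
      "\<alpha> ^ ?Rbc (h(c := y)) * g (?Rbc (h(c := y))) = \<alpha> ^ ?Rbc h * g (?Rbc h)" for h y
      using fun_upd_twist[OF \<open>b \<noteq> c\<close>, of h 0 y] by simp_all
  qed (use assms(2,3,6) in \<open>auto simp: power_le_one\<close>)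
  finally show ?thesis by (simp add: power2_eq_square mult.assoc)
qed

lemma sum_nat_lessThan: "(\<Sum>s<m. real s) = real m * (real m - 1) / 2"
  by (induction m) (auto simp: field_simps)

text \<open>The identifier at position \<open>s\<close> has \<open>s\<close> predecessors and
  \<open>m - 1 - s\<close> successors. Since \<open>1 / \<alpha> = 1 + d\<close>, its term is affine
  in \<open>s\<close> with slope \<open>d * d\<close>: the factor \<open>1 / \<alpha>\<close>
  enlarges each of the \<open>s\<close> earlier gains \<open>d\<close> by
  \<open>d * d\<close>.\<close>

lemma sum_expectation_inverse_threshold_upd:
  assumes "finite U" "0 < \<alpha>" "\<alpha> \<le> 1" "distinct cs" "set cs \<subseteq> U"
  defines "d \<equiv> 1 / \<alpha> - 1" and "m \<equiv> real (length cs)"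
  shows "(\<Sum>b\<in>set cs. \<integral>h. 1 / \<alpha> ^ tcf_count \<alpha> (h(b := 0)) cs 0 \<partial>hashes U)
    = m * (1 + d) + d * (2 + d) * m * (m - 1) / 2"
proof -
  let ?e = "\<lambda>b. \<integral>h. 1 / \<alpha> ^ tcf_count \<alpha> (h(b := 0)) cs 0 \<partial>hashes U"
  have "(\<Sum>b\<in>set cs. ?e b) = (\<Sum>s<length cs. ?e (cs ! s))"
    by (rule sum.reindex_bij_betw[symmetric]) (simp add: bij_betw_nth assms(4))
  also have "\<dots> = (\<Sum>s<length cs. (1 + d) + d * (m - 1) + d * d * real s)"
  proof (rule sum.cong[OF refl])
    fix s assume "s \<in> {..<length cs}"
    then have s: "s < length cs" by simp
    note split = id_take_nth_drop[OF s]
    have "?e (cs ! s) = (1 + real (length (take s cs)) * d) / \<alpha> + length (drop (Suc s) cs) * d"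
      using expectation_inverse_threshold_upd[OF assms(1-3), of "take s cs" "cs ! s" "drop (Suc s) cs" 0]
        assms(4,5) unfolding split[symmetric] d_def by simp
    also have "\<dots> = (1 + real s * d) / \<alpha> + (m - 1 - real s) * d"
      using s by (simp add: m_def of_nat_diff)
    also have "\<dots> = (1 + d) + d * (m - 1) + d * d * real s"
    proof -
      have "1 / \<alpha> = 1 + d" by (simp add: d_def)
      then have "(1 + real s * d) / \<alpha> = (1 + real s * d) * (1 + d)"
        by (metis times_divide_eq_right mult.right_neutral)
      then show ?thesis by (simp add: algebra_simps)
    qed
    finally show "?e (cs ! s) = (1 + d) + d * (m - 1) + d * d * real s" .
  qed
  also have "\<dots> = m * ((1 + d) + d * (m - 1)) + d * d * (m * (m - 1) / 2)"
    by (simp add: sum.distrib sum_distrib_left[symmetric] sum_nat_lessThan m_def)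
  also have "\<dots> = m * (1 + d) + d * (2 + d) * m * (m - 1) / 2"
    by (simp add: field_simps)
  finally show ?thesis .
qed

section \<open>Mean and variance of the estimate\<close>

text \<open>The collision-free form of the estimate. \<open>W\<close> is separate from
  \<open>cs\<close> because the prefix identifiers are counted in the sample but never move the
  counter.\<close>

definition tcf_estimate :: "real \<Rightarrow> nat set \<Rightarrow> nat list \<Rightarrow> (nat \<Rightarrow> real) \<Rightarrow> real" where
  "tcf_estimate \<alpha> W cs h =
    real (card {a \<in> W. h a < \<alpha> ^ tcf_count \<alpha> h cs 0}) / \<alpha> ^ tcf_count \<alpha> h cs 0"

lemma tcf_estimate_eq_sum:
  assumes "finite W"
  shows "tcf_estimate \<alpha> W cs h =
    (\<Sum>a\<in>W. if h a < \<alpha> ^ tcf_count \<alpha> h cs 0 then 1 / \<alpha> ^ tcf_count \<alpha> h cs 0 else 0)"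
  using assms by (simp add: tcf_estimate_def sum.If_cases Int_def)

lemma tcf_estimate_power2_eq_sum:
  assumes "finite W"
  shows "(tcf_estimate \<alpha> W cs h)\<^sup>2 = (\<Sum>a\<in>W. \<Sum>b\<in>W.
    if h a < \<alpha> ^ tcf_count \<alpha> h cs 0 \<and> h b < \<alpha> ^ tcf_count \<alpha> h cs 0
    then 1 / (\<alpha> ^ tcf_count \<alpha> h cs 0)\<^sup>2 else 0)"
proof -
  have "(if p then x else 0) * (if q then x else 0) = (if p \<and> q then x\<^sup>2 else 0)" for p q and x :: real
    by (simp add: power2_eq_square)
  then show ?thesis
    unfolding tcf_estimate_eq_sum[OF assms] power2_eq_square[of "sum f W" for f] sum_product
    by (simp only: power_divide power_one)
qed

lemma integrable_sampled:
  fixes g :: "nat \<Rightarrow> real"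
  shows "integrable (hashes U) (\<lambda>h. if h a < \<alpha> ^ tcf_count \<alpha> h cs i \<and> h b < \<alpha> ^ tcf_count \<alpha> h cs i
    then g (tcf_count \<alpha> h cs i) else 0)"
proof (rule integrable_If_0[OF integrable_tcf_count])
  have [measurable]: "(\<lambda>h. \<alpha> ^ tcf_count \<alpha> h cs i) \<in> borel_measurable (hashes U)"
    by (rule borel_measurable_integrable[OF integrable_tcf_count])
  show "Measurable.pred (hashes U)
      (\<lambda>h. h a < \<alpha> ^ tcf_count \<alpha> h cs i \<and> h b < \<alpha> ^ tcf_count \<alpha> h cs i)"
    by measurable
qed

lemma integrable_sampled1:
  fixes g :: "nat \<Rightarrow> real"
  shows "integrable (hashes U)
    (\<lambda>h. if h a < \<alpha> ^ tcf_count \<alpha> h cs i then g (tcf_count \<alpha> h cs i) else 0)"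
  using integrable_sampled[of U a \<alpha> cs i a g] by (simp only: conj_absorb)

lemma integrable_tcf_estimate:
  assumes "finite W"
  shows "integrable (hashes U) (tcf_estimate \<alpha> W cs)"
    and "integrable (hashes U) (\<lambda>h. (tcf_estimate \<alpha> W cs h)\<^sup>2)"
proof -
  have eq: "tcf_estimate \<alpha> W cs = (\<lambda>h.
      \<Sum>a\<in>W. if h a < \<alpha> ^ tcf_count \<alpha> h cs 0 then 1 / \<alpha> ^ tcf_count \<alpha> h cs 0 else 0)"
    by (rule ext) (rule tcf_estimate_eq_sum[OF assms])
  show "integrable (hashes U) (tcf_estimate \<alpha> W cs)"
    unfolding eq
    by (intro Bochner_Integration.integrable_sum integrable_sampled1[where g="\<lambda>j. 1 / \<alpha> ^ j"])
  show "integrable (hashes U) (\<lambda>h. (tcf_estimate \<alpha> W cs h)\<^sup>2)"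
    unfolding tcf_estimate_power2_eq_sum[OF assms]
    by (intro Bochner_Integration.integrable_sum integrable_sampled[where g="\<lambda>j. 1 / (\<alpha> ^ j)\<^sup>2"])
qed

text \<open>For each identifier the inclusion factor cancels the inverse threshold, leaving
  \<open>1\<close>.\<close>

lemma expectation_tcf_estimate:
  assumes "finite U" "0 < \<alpha>" "\<alpha> \<le> 1" "W \<subseteq> U"
  shows "(\<integral>h. tcf_estimate \<alpha> W cs h \<partial>hashes U) = card W"
proof -
  have W: "finite W" using assms(1,4) finite_subset by blast
  have "(\<integral>h. tcf_estimate \<alpha> W cs h \<partial>hashes U) = (\<Sum>a\<in>W. \<integral>h.
      (if h a < \<alpha> ^ tcf_count \<alpha> h cs 0 then 1 / \<alpha> ^ tcf_count \<alpha> h cs 0 else 0) \<partial>hashes U)"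
    unfolding tcf_estimate_eq_sum[OF W]
    by (intro Bochner_Integration.integral_sum integrable_sampled1[where g="\<lambda>j. 1 / \<alpha> ^ j"])
  also have "\<dots> = (\<Sum>a\<in>W. 1)"
    using assms by (intro sum.cong refl)
      (subst expectation_sampled[where g="\<lambda>j. 1 / \<alpha> ^ j"],
        auto simp: prob_space.prob_space[OF prob_space_hashes])
  finally show ?thesis by simp
qed

text \<open>Off the diagonal the two inclusion factors cancel the squared inverse threshold, so each
  ordered pair gives \<open>1\<close>. On the diagonal only one factor is available and one inverse
  threshold remains.\<close>

lemma expectation_tcf_estimate_power2:
  assumes "finite U" "0 < \<alpha>" "\<alpha> \<le> 1" "W \<subseteq> U"
  shows "(\<integral>h. (tcf_estimate \<alpha> W cs h)\<^sup>2 \<partial>hashes U)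
    = (real (card W))\<^sup>2 - card W + (\<Sum>a\<in>W. \<integral>h. 1 / \<alpha> ^ tcf_count \<alpha> (h(a := 0)) cs 0 \<partial>hashes U)"
proof -
  have W: "finite W" using assms(1,4) finite_subset by blast
  define R where "R = (\<lambda>h. tcf_count \<alpha> h cs 0)"
  define E where "E = (\<lambda>a b. \<integral>h. (if h a < \<alpha> ^ R h \<and> h b < \<alpha> ^ R h then 1 / (\<alpha> ^ R h)\<^sup>2 else 0) \<partial>hashes U)"
  let ?e = "\<lambda>a. \<integral>h. 1 / \<alpha> ^ R (h(a := 0)) \<partial>hashes U"
  have diag: "E a a = ?e a" if "a \<in> W" for a
  proof -
    have "E a a = (\<integral>h. \<alpha> ^ R (h(a := 0)) * (1 / (\<alpha> ^ R (h(a := 0)))\<^sup>2) \<partial>hashes U)"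
      using expectation_sampled[where g="\<lambda>j. 1 / (\<alpha> ^ j)\<^sup>2", of U \<alpha> a cs 0] that assms
      unfolding E_def R_def by auto
    then show ?thesis using assms(2) by (simp add: power2_eq_square)
  qed
  have off: "E a b = 1" if "a \<in> W" "b \<in> W" "a \<noteq> b" for a b
  proof -
    have "E a b = (\<integral>h. (\<alpha> ^ R (h(a := 0, b := 0)))\<^sup>2 * (1 / (\<alpha> ^ R (h(a := 0, b := 0)))\<^sup>2) \<partial>hashes U)"
      unfolding E_def R_def
      using that assms by (intro expectation_sampled_pair[where g="\<lambda>j. 1 / (\<alpha> ^ j)\<^sup>2"]) auto
    then show ?thesis using assms(2) by (simp add: prob_space.prob_space[OF prob_space_hashes])
  qed
  have "(\<integral>h. (tcf_estimate \<alpha> W cs h)\<^sup>2 \<partial>hashes U) = (\<Sum>a\<in>W. \<Sum>b\<in>W. E a b)"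
    unfolding tcf_estimate_power2_eq_sum[OF W] E_def R_def
    using integrable_sampled[where g="\<lambda>j. 1 / (\<alpha> ^ j)\<^sup>2"] by simp
  also have "\<dots> = (\<Sum>a\<in>W. ?e a + (real (card W) - 1))"
  proof (rule sum.cong[OF refl])
    fix a assume a: "a \<in> W"
    have "(\<Sum>b\<in>W. E a b) = E a a + (\<Sum>b\<in>W - {a}. E a b)" by (rule sum.remove[OF W a])
    also have "(\<Sum>b\<in>W - {a}. E a b) = (\<Sum>b\<in>W - {a}. 1)" using a off by (intro sum.cong) auto
    also have "\<dots> = real (card W) - 1"
      using a W card_gt_0_iff[of W] by (auto simp: card_Diff_singleton of_nat_diff Suc_leI)
    finally show "(\<Sum>b\<in>W. E a b) = ?e a + (real (card W) - 1)" using diag[OF a] by simp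
  qed
  also have "\<dots> = (real (card W))\<^sup>2 - card W + (\<Sum>a\<in>W. ?e a)"
    by (simp add: sum.distrib power2_eq_square right_diff_distrib)
  finally show ?thesis by (simp add: R_def)
qed

lemma variance_tcf_estimate:
  fixes k :: nat
  assumes "finite U" "k > 0" "finite P" "card P = k" "distinct cs" "P \<inter> set cs = {}" "P \<union> set cs \<subseteq> U"
  defines "n \<equiv> real (card (P \<union> set cs))"
  shows "prob_space.variance (hashes U) (tcf_estimate (alpha k) (P \<union> set cs) cs)
    = ((2 * real k + 1) * n\<^sup>2 - ((real k)\<^sup>2 + real k) * (2 * n - 1) - n) / (2 * (real k)\<^sup>2)"
proof -
  interpret prob_space "hashes U" by (rule prob_space_hashes)
  define \<alpha> where "\<alpha> = alpha k"
  define m where "m = real (length cs)"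
  have \<alpha>: "0 < \<alpha>" "\<alpha> \<le> 1" "1 / \<alpha> - 1 = 1 / k" using assms(2) by (auto simp: \<alpha>_def alpha_def field_simps)
  have n: "n = k + m"
    using assms(3-6) by (simp add: n_def m_def card_Un_disjoint distinct_card)
  let ?e = "\<lambda>a. \<integral>h. 1 / \<alpha> ^ tcf_count \<alpha> (h(a := 0)) cs 0 \<partial>hashes U"
  \<comment> \<open>A prefix identifier does not occur in \<open>cs\<close>, so setting it to
    \<open>0\<close> leaves the run unchanged.\<close>
  have "?e a = 1 + m / k" if "a \<in> P" for a
  proof -
    have "a \<notin> set cs" using that assms(6) by auto
    then show ?thesis
      using expectation_inverse_threshold[OF assms(1) \<alpha>(1,2) assms(5), of 0] assms(7) \<alpha>(3)
      by (simp add: m_def)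
  qed
  then have eP: "(\<Sum>a\<in>P. ?e a) = k * (1 + m / k)" using assms(4) by simp
  have "(\<Sum>a\<in>P \<union> set cs. ?e a) = (\<Sum>a\<in>P. ?e a) + (\<Sum>a\<in>set cs. ?e a)"
    using assms(3,6) by (intro sum.union_disjoint) auto
  also have "\<dots> = k * (1 + m / k) + (m * (1 + 1 / k) + 1 / k * (2 + 1 / k) * m * (m - 1) / 2)"
    using sum_expectation_inverse_threshold_upd[OF assms(1) \<alpha>(1,2) assms(5)] assms(7)
    unfolding eP \<alpha>(3) m_def by simp
  finally have e: "(\<Sum>a\<in>P \<union> set cs. ?e a)
      = k * (1 + m / k) + (m * (1 + 1 / k) + 1 / k * (2 + 1 / k) * m * (m - 1) / 2)" .
  have "finite (P \<union> set cs)" using assms(3) by simp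
  then have "variance (tcf_estimate \<alpha> (P \<union> set cs) cs)
      = expectation (\<lambda>h. (tcf_estimate \<alpha> (P \<union> set cs) cs h)\<^sup>2)
        - (expectation (tcf_estimate \<alpha> (P \<union> set cs) cs))\<^sup>2"
    by (intro variance_eq integrable_tcf_estimate)
  \<comment> \<open>The mean is \<open>n\<close>, so its square cancels against the off-diagonal
    part; only the diagonal sum minus \<open>n\<close> survives.\<close>
  also have "\<dots> = k * (1 + m / k) + (m * (1 + 1 / k) + 1 / k * (2 + 1 / k) * m * (m - 1) / 2) - n"
    using expectation_tcf_estimate[OF assms(1) \<alpha>(1,2) assms(7), of cs]
      expectation_tcf_estimate_power2[OF assms(1) \<alpha>(1,2) assms(7), of cs] e
    by (simp add: n_def)
  also have "\<dots> = ((2 * real k + 1) * n\<^sup>2 - ((real k)\<^sup>2 + real k) * (2 * n - 1) - n) / (2 * (real k)\<^sup>2)"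
    using assms(2) unfolding n by (simp add: field_simps power2_eq_square)
  finally show ?thesis by (simp add: \<alpha>_def)
qed

section \<open>Measurability and transfer to the given probability space\<close>

text \<open>The same step with the stored hash values replaced by the identifiers they come from: its
  states range over a countable type, which makes the counter measurable also where hash values
  collide.\<close>
definition id_step :: "real \<Rightarrow> (nat \<Rightarrow> real) \<Rightarrow> nat \<Rightarrow> nat \<times> nat list \<Rightarrow> nat \<times> nat list" where
  "id_step \<alpha> h a st =
    (if h a < \<alpha> ^ fst st \<and> h a \<notin> h ` set (snd st) then (Suc (fst st), a # snd st) else st)"

text \<open>Simulation invariant: the stored set \<open>D\<close> is the image under
  \<open>h\<close> of the stored identifiers.\<close>

lemma fold_alphaTCF_step_id_step:
  "fold (alphaTCF_step \<alpha>) (map h bs) (fst st, h ` set (snd st))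
    = (let st' = fold (id_step \<alpha> h) bs st in (fst st', h ` set (snd st')))"
proof (induction bs arbitrary: st)
  case (Cons b bs)
  have "alphaTCF_step \<alpha> (h b) (fst st, h ` set (snd st))
      = (fst (id_step \<alpha> h b st), h ` set (snd (id_step \<alpha> h b st)))"
    by (auto simp: id_step_def)
  then show ?case using Cons.IH[of "id_step \<alpha> h b st"] by simp
qed (simp add: Let_def)

lemma measurable_fold_id_step:
  assumes f: "\<And>c. (\<lambda>x. f x c) \<in> borel_measurable M"
    and "st \<in> M \<rightarrow>\<^sub>M count_space UNIV"
  shows "(\<lambda>x. fold (id_step \<alpha> (f x)) bs (st x)) \<in> M \<rightarrow>\<^sub>M count_space UNIV"
  using assms(2)
proof (induction bs arbitrary: st)
  case (Cons b bs)
  have "(\<lambda>x. id_step \<alpha> (f x) b s) \<in> M \<rightarrow>\<^sub>M count_space UNIV" for s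
  proof -
    note [measurable] = f
    have "Measurable.pred M (\<lambda>x. f x b < \<alpha> ^ fst s \<and> (\<forall>c\<in>set (snd s). f x b \<noteq> f x c))"
      by measurable
    moreover have "f x b \<notin> f x ` set (snd s) \<longleftrightarrow> (\<forall>c\<in>set (snd s). f x b \<noteq> f x c)" for x
      by auto
    ultimately show ?thesis unfolding id_step_def by (intro measurable_If) simp_all
  qed
  then have "(\<lambda>x. id_step \<alpha> (f x) b (st x)) \<in> M \<rightarrow>\<^sub>M count_space UNIV"
    by (rule measurable_compose_countable[OF _ Cons.prems])
  from Cons.IH[OF this] show ?case by simp
qed simp

text \<open>Each identifier adds one unless its value equals an earlier one, which is a finite union
  of measurable events.\<close>

lemma measurable_card_image_set:
  fixes f :: "'x \<Rightarrow> nat \<Rightarrow> real"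
  assumes [measurable]: "\<And>c. (\<lambda>x. f x c) \<in> borel_measurable M"
  shows "(\<lambda>x. card (f x ` set bs)) \<in> M \<rightarrow>\<^sub>M count_space UNIV"
proof (induction bs)
  case (Cons b bs)
  note [measurable] = Cons.IH
  have "card (f x ` set (b # bs)) =
      (if \<exists>c\<in>set bs. f x b = f x c then card (f x ` set bs) else Suc (card (f x ` set bs)))" for x
    by (auto simp: card_insert_if)
  then show ?case by simp
qed simp

text \<open>The prefix length is a least index over measurable events. For each fixed length the run
  is measurable, and there are countably many lengths.\<close>

lemma measurable_alphaTCF_counter:
  assumes f: "\<And>c. (\<lambda>x. f x c) \<in> borel_measurable M"
  shows "(\<lambda>x. alphaTCF_counter k A (f x)) \<in> M \<rightarrow>\<^sub>M count_space UNIV"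
proof -
  define m where "m = (\<lambda>x. prefix_length k (map (f x) A))"
  have "(\<lambda>x. card (f x ` set (take j A))) \<in> M \<rightarrow>\<^sub>M count_space UNIV" for j
    by (rule measurable_card_image_set[OF f])
  then have "Measurable.pred M (\<lambda>x. card (f x ` set (take j A)) = k)" for j
    by (rule measurable_compose) simp
  then have m: "m \<in> M \<rightarrow>\<^sub>M count_space UNIV"
    unfolding m_def prefix_length_def by (simp add: take_map measurable_Least)
  have eq: "alphaTCF_counter k A (f x)
      = fst (fold (id_step (alpha k) (f x)) (drop (m x) A) (0, take (m x) A))" for x
    using fold_alphaTCF_step_id_step[of "alpha k" "f x" "drop (m x) A" "(0, take (m x) A)"]
    by (simp add: alphaTCF_counter_def m_def Let_def take_map drop_map)
  have "(\<lambda>x. fst (fold (id_step (alpha k) (f x)) (drop j A) (0, take j A))) \<in> M \<rightarrow>\<^sub>M count_space UNIV" for j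
    by (rule measurable_compose[OF measurable_fold_id_step[OF f]]) simp_all
  then have "(\<lambda>x. fst (fold (id_step (alpha k) (f x)) (drop (m x) A) (0, take (m x) A)))
      \<in> M \<rightarrow>\<^sub>M count_space UNIV"
    by (rule measurable_compose_countable[OF _ m])
  then show ?thesis unfolding eq .
qed

lemma borel_measurable_sample_size_div_alphaTCF:
  "(\<lambda>h. real (sample_size k A h) / alphaTCF k A h) \<in> borel_measurable (hashes U)"
proof -
  have [measurable]: "alphaTCF k A \<in> borel_measurable (hashes U)"
    unfolding alphaTCF_def[abs_def]
    by (rule measurable_compose[OF measurable_alphaTCF_counter[where f="\<lambda>h. h", OF measurable_hash]]) simp
  have "real (sample_size k A h) = (\<Sum>a\<in>set A. if h a < alphaTCF k A h then 1 else 0)" for h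
    by (simp add: sample_size_def sum.If_cases Int_def)
  then show ?thesis by simp
qed

section \<open>Transfer of the variance to the product measure\<close>

lemma alphaTCF_cong:
  assumes "\<And>a. a \<in> set A \<Longrightarrow> h a = h' a"
  shows "alphaTCF k A h = alphaTCF k A h'" "sample_size k A h = sample_size k A h'"
proof -
  have map: "map h A = map h' A" using assms by simp
  show eq: "alphaTCF k A h = alphaTCF k A h'" unfolding alphaTCF_def alphaTCF_counter_def map ..
  show "sample_size k A h = sample_size k A h'"
    unfolding sample_size_def eq using assms by (intro arg_cong[where f=card]) auto
qed

text \<open>Independence means that the joint law is the product of the marginals, each of which is
  uniform. Restriction to \<open>{1..n}\<close> makes the hash function a point of the product
  space.\<close>

lemma distr_perfectly_random_hash:
  assumes "prob_space M" "perfectly_random_hash M n H" "n > 0"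
  shows "(\<lambda>\<omega>. \<lambda>a\<in>{1..n}. H a \<omega>) \<in> M \<rightarrow>\<^sub>M Pi\<^sub>M {1..n} (\<lambda>_. borel)"
    and "distr M (Pi\<^sub>M {1..n} (\<lambda>_. borel)) (\<lambda>\<omega>. \<lambda>a\<in>{1..n}. H a \<omega>) = hashes {1..n}"
proof -
  interpret prob_space M by fact
  have ind: "indep_vars (\<lambda>_. borel) H {1..n}"
    and unif: "\<And>a. a \<in> {1..n} \<Longrightarrow> distr M borel (H a) = unif"
    using assms(2) by (auto simp: perfectly_random_hash_def)
  have rv: "\<And>a. a \<in> {1..n} \<Longrightarrow> random_variable borel (H a)"
    using ind by (auto simp: indep_vars_def)
  show "(\<lambda>\<omega>. \<lambda>a\<in>{1..n}. H a \<omega>) \<in> M \<rightarrow>\<^sub>M Pi\<^sub>M {1..n} (\<lambda>_. borel)"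
    using rv by (rule measurable_restrict)
  have "distr M (Pi\<^sub>M {1..n} (\<lambda>_. borel)) (\<lambda>\<omega>. \<lambda>a\<in>{1..n}. H a \<omega>)
      = Pi\<^sub>M {1..n} (\<lambda>a. distr M borel (H a))"
    using ind assms(3) rv by (subst (asm) indep_vars_iff_distr_eq_PiM') auto
  also have "\<dots> = hashes {1..n}" using unif by (intro PiM_cong) auto
  finally show "distr M (Pi\<^sub>M {1..n} (\<lambda>_. borel)) (\<lambda>\<omega>. \<lambda>a\<in>{1..n}. H a \<omega>) = hashes {1..n}" .
qed

lemma variance_perfectly_random_hash:
  fixes k :: nat
  assumes "prob_space M" "perfectly_random_hash M n H" "n > 0" "set A \<subseteq> {1..n}"
  defines "X \<equiv> \<lambda>h. real (sample_size k A h) / alphaTCF k A h"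
  shows "prob_space.variance M (\<lambda>\<omega>. X (\<lambda>a. H a \<omega>)) = prob_space.variance (hashes {1..n}) X"
proof -
  let ?N = "Pi\<^sub>M {1..n} (\<lambda>_. borel :: real measure)" and ?r = "\<lambda>\<omega>. \<lambda>a\<in>{1..n}. H a \<omega>"
  note r = distr_perfectly_random_hash[OF assms(1-3)]
  have "X \<in> borel_measurable (hashes {1..n})"
    unfolding X_def by (rule borel_measurable_sample_size_div_alphaTCF)
  \<comment> \<open>\<open>unif\<close> and \<open>borel\<close> have the same measurable sets, so
    both products carry the same \<sigma>-algebra.\<close>
  moreover have "sets (hashes {1..n}) = sets ?N" by (intro sets_PiM_cong) simp_all
  ultimately have X [measurable]: "X \<in> borel_measurable ?N"
    using measurable_cong_sets[OF _ refl] by blast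
  have XH: "X (\<lambda>a. H a \<omega>) = X (?r \<omega>)" for \<omega>
    unfolding X_def using assms(4)
    by (intro arg_cong2[where f="(/)"] arg_cong[where f=real] alphaTCF_cong) auto
  have E: "(\<integral>\<omega>. f (X (?r \<omega>)) \<partial>M) = (\<integral>h. f (X h) \<partial>hashes {1..n})"
    if [measurable]: "f \<in> borel_measurable borel" for f :: "real \<Rightarrow> real"
    unfolding r(2)[symmetric] by (rule integral_distr[OF r(1), symmetric]) measurable
  \<comment> \<open>The change of variables is used twice, for the mean and for the squared
    deviation from it.\<close>
  show ?thesis
    unfolding XH using E[of "\<lambda>x. x"] E[of "\<lambda>x. (x - (\<integral>h. X h \<partial>hashes {1..n}))\<^sup>2"] by simp
qed

lemma variance_cong_AE:
  fixes X Y :: "'x \<Rightarrow> real"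
  assumes "AE x in M. X x = Y x" "prob_space M"
    and [measurable]: "X \<in> borel_measurable M" "Y \<in> borel_measurable M"
  shows "prob_space.variance M X = prob_space.variance M Y"
proof -
  have "integral\<^sup>L M X = integral\<^sup>L M Y" using assms by (intro integral_cong_AE) auto
  moreover have "AE x in M. (X x - c)\<^sup>2 = (Y x - c)\<^sup>2" for c
    using assms(1) by eventually_elim simp
  ultimately show ?thesis by (auto intro!: integral_cong_AE)
qed

text \<open>Dropping the nonnegative subtracted terms leaves
  \<open>(2 * k + 1) * n\<^sup>2 / (2 * k\<^sup>2)\<close>. The bound is then strict since
  \<open>(2 * k + 1) * (k - 1 / 2) = 2 * k\<^sup>2 - 1 / 2\<close>.\<close>

lemma variance_bound:
  fixes k n :: real
  assumes "k \<ge> 1" "n \<ge> 1"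
  shows "((2 * k + 1) * n\<^sup>2 - (k\<^sup>2 + k) * (2 * n - 1) - n) / (2 * k\<^sup>2) < n\<^sup>2 / (k - 1 / 2)"
proof -
  have "0 \<le> (k\<^sup>2 + k) * (2 * n - 1)" using assms by (intro mult_nonneg_nonneg) auto
  then have "((2 * k + 1) * n\<^sup>2 - (k\<^sup>2 + k) * (2 * n - 1) - n) / (2 * k\<^sup>2) \<le> (2 * k + 1) * n\<^sup>2 / (2 * k\<^sup>2)"
    using assms by (intro divide_right_mono) (linarith, simp)
  also have "\<dots> < n\<^sup>2 / (k - 1 / 2)"
  proof -
    have "(2 * k + 1) * (k - 1 / 2) < 2 * k\<^sup>2" by (simp add: algebra_simps power2_eq_square)
    then have "n\<^sup>2 * ((2 * k + 1) * (k - 1 / 2)) < n\<^sup>2 * (2 * k\<^sup>2)"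
      using assms by (intro mult_strict_left_mono) auto
    then show ?thesis using assms by (simp add: frac_less_eq pos_divide_less_eq pos_less_divide_eq mult_ac)
  qed
  finally show ?thesis .
qed

theorem theorem14:
  fixes M :: "'w measure" and H :: "nat \<Rightarrow> 'w \<Rightarrow> real"
    and A :: "nat list" and k n n\<^sub>A :: nat
  assumes "prob_space M"
    and "perfectly_random_hash M n H"
    and "set A \<subseteq> {1..n}"
    and "k > 0"
    and "n\<^sub>A = card (set A)"
    and "n\<^sub>A \<ge> k"
  shows "let v = prob_space.variance M
               (\<lambda>\<omega>. real (sample_size k A (\<lambda>a. H a \<omega>)) / alphaTCF k A (\<lambda>a. H a \<omega>))
         in v = ((2 * real k + 1) * (real n\<^sub>A)\<^sup>2 - ((real k)\<^sup>2 + real k) * (2 * real n\<^sub>A - 1) - real n\<^sub>A)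
                  / (2 * (real k)\<^sup>2)
            \<and> v < (real n\<^sub>A)\<^sup>2 / (real k - 1 / 2)"
proof -
  let ?U = "{1..n}"
  let ?X = "\<lambda>h. real (sample_size k A h) / alphaTCF k A h"
  have "n > 0" using assms by (cases n) auto
  obtain P cs where P: "card P = k" "finite P" "P \<inter> set cs = {}" and cs: "distinct cs"
    and A: "set A = P \<union> set cs"
    and counter: "\<And>h. inj_on h (set A) \<Longrightarrow> alphaTCF_counter k A h = tcf_count (alpha k) h cs 0"
    using alphaTCF_counter_inj[of k A] assms(4-6) by metis
  \<comment> \<open>Off the null set of collisions, the actual run and the chain on
    \<open>cs\<close> agree, which suffices for equal variances.\<close>
  have "AE h in hashes ?U. inj_on h ?U" by (rule AE_hashes_inj_on) simp
  then have AE: "AE h in hashes ?U. ?X h = tcf_estimate (alpha k) (P \<union> set cs) cs h"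
  proof eventually_elim
    case (elim h)
    then have "inj_on h (set A)" using assms(3) by (rule inj_on_subset)
    from counter[OF this] show ?case
      unfolding sample_size_def alphaTCF_def tcf_estimate_def A by simp
  qed
  have "prob_space.variance M (\<lambda>\<omega>. ?X (\<lambda>a. H a \<omega>)) = prob_space.variance (hashes ?U) ?X"
    by (rule variance_perfectly_random_hash[OF assms(1,2) \<open>n > 0\<close> assms(3)])
  also have "\<dots> = prob_space.variance (hashes ?U) (tcf_estimate (alpha k) (P \<union> set cs) cs)"
    using AE prob_space_hashes borel_measurable_sample_size_div_alphaTCF
  proof (rule variance_cong_AE)
    show "tcf_estimate (alpha k) (P \<union> set cs) cs \<in> borel_measurable (hashes ?U)"
      using P(2) by (intro borel_measurable_integrable integrable_tcf_estimate) simp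
  qed
  also have "\<dots> = ((2 * real k + 1) * (real n\<^sub>A)\<^sup>2 - ((real k)\<^sup>2 + real k) * (2 * real n\<^sub>A - 1) - real n\<^sub>A)
      / (2 * (real k)\<^sup>2)"
    unfolding assms(5) A using assms(3,4) P cs A by (intro variance_tcf_estimate) auto
  finally show ?thesis
    using variance_bound[of k n\<^sub>A] assms(4,6) by (simp add: Let_def)
qed

end
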